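(* Let $K\subseteq\mathbb{R}^n$ be a closed proper convex cone with nonempty interior, $g:[0,\pi]\to\mathbb{R}$ continuous, strictly increasing, convex on $[0,\pi/2]$ and concave on $[\pi/2,\pi]$, and $\psi(w)=\int_{K_1} g(\rho(w,y))\,d\sigma(y)$ for $w\in\mathcal{S}^{n-1}$. Then $\psi$ has a unique global minimum point on $\mathcal{S}^{n-1}$, and this point is the only local minimum point of $\psi$ on $\mathcal{S}^{n-1}$.
   Context: $\mathcal{S}^{n-1}$ is the Euclidean unit sphere in $\mathbb{R}^n$, $\sigma$ the normalized uniform measure on it, $\rho(w,y)=\arccos\langle w,y\rangle$ the geodesic distance. For $A\subseteq\mathbb{R}^n$, $A_1=A\cap\mathcal{S}^{n-1}$. A convex cone is proper if it is contained in some closed halfspace through the origin.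
   Formalization: The dimension n is assumed to be at least 2; for n = 1 the sphere is the discrete set {-1,1}, both points are local minimum points of ψ, and the claim that the global minimum point is the only local one fails. *)

theory Defs
  imports "HOL-Analysis.Analysis"
begin

text \<open>Normalized uniform (surface) measure on the unit sphere, realised as the
  push-forward of the uniform probability measure on the unit ball under radial
  projection x \<mapsto> x/|x| (the cone-measure description of sigma). It lives on
  the Borel sets of the whole space but is concentrated on the unit sphere.\<close>
definition sphere_measure :: "'a::euclidean_space measure" where
  "sphere_measure = distr (uniform_measure lborel (ball 0 1)) borel (\<lambda>x. x /\<^sub>R norm x)"

definition geod :: "'a::euclidean_space \<Rightarrow> 'a \<Rightarrow> real" where
  "geod w y = arccos (inner w y)"

definition proper_cone :: "'a::euclidean_space set \<Rightarrow> bool" where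
  "proper_cone K \<longleftrightarrow> (\<exists>a. a \<noteq> 0 \<and> (\<forall>x\<in>K. 0 \<le> inner a x))"

definition psi :: "'a::euclidean_space set \<Rightarrow> (real \<Rightarrow> real) \<Rightarrow> 'a \<Rightarrow> real" where
  "psi K g w = (LINT y : K \<inter> sphere 0 1 | sphere_measure. g (geod w y))"

definition sphere_local_min :: "('a::euclidean_space \<Rightarrow> real) \<Rightarrow> 'a \<Rightarrow> bool" where
  "sphere_local_min f w \<longleftrightarrow> w \<in> sphere 0 1 \<and>
     (\<exists>e>0. \<forall>v\<in>sphere 0 1. dist v w < e \<longrightarrow> f w \<le> f v)"

definition sphere_global_min :: "('a::euclidean_space \<Rightarrow> real) \<Rightarrow> 'a \<Rightarrow> bool" where
  "sphere_global_min f w \<longleftrightarrow> w \<in> sphere 0 1 \<and> (\<forall>v\<in>sphere 0 1. f w \<le> f v)"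

end

(*
  Write h = g o arccos, so that psi w is the integral of h <w,y> over y in K1, and let K* be the
  dual cone.

  Reflecting w in the hyperplane orthogonal to an interior point q of K with <w,q> < 0 strictly
  decreases psi, because K + q is contained in K.  If w is outside K* and orthogonal to some nonzero
  z in K, taking q -> z gives smaller values arbitrarily close to w.  If w is outside K* and
  orthogonal to no such z, then K \ {0} lies in <w,y> < 0: for -w outside K a vector separating
  -w from K is a descent direction, and for -w in K the concavity of g on [pi/2, pi] makes psi
  strictly smaller at one of two opposite neighbours of w.  So local minimum points lie in K*, and
  a separation argument puts them in K as well.

  On K* all angles are at most pi/2, so psi is midpoint convex there, and strictly so when the
  midpoint m lies in K, as seen from the points y near m.  Two distinct minimum points would have a
  midpoint that is again a minimum point, hence lies in K, contradicting strictness.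
*)
theory Submission
  imports Defs
begin

section \<open>Lebesgue measure under linear isometric involutions\<close>

lemma emeasure_lborel_open_pos:
  fixes U :: "'a::euclidean_space set"
  assumes "open U" "U \<noteq> {}"
  shows "emeasure lborel U > 0"
proof -
  have "U \<notin> null_sets lborel"
    using open_not_negligible[OF assms] by (auto simp: negligible_iff_null_sets null_sets_completionI)
  then show ?thesis using assms by (auto simp: null_sets_def zero_less_iff_neq_zero)
qed

lemma nn_integral_lborel_translation:
  fixes f :: "'a::euclidean_space \<Rightarrow> ennreal"
  assumes [measurable]: "f \<in> borel_measurable borel"
  shows "(\<integral>\<^sup>+ x. f (c + x) \<partial>lborel) = (\<integral>\<^sup>+ x. f x \<partial>lborel)"
proof -
  have "(\<integral>\<^sup>+ x. f x \<partial>lborel) = (\<integral>\<^sup>+ x. f x \<partial>distr lborel borel ((+) c))"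
    by (simp add: lborel_distr_plus)
  also have "\<dots> = (\<integral>\<^sup>+ x. f (c + x) \<partial>lborel)"
    by (rule nn_integral_distr) auto
  finally show ?thesis ..
qed

text \<open>Two translation-invariant measures are proportional by Fubini; the unit ball fixes the
  constant.\<close>
lemma lborel_distr_isometric_involution:
  fixes T :: "'a::euclidean_space \<Rightarrow> 'a"
  assumes lin: "linear T" and inv: "\<And>x. T (T x) = x" and iso: "\<And>x. norm (T x) = norm x"
  shows "distr lborel borel T = lborel"
proof (rule measure_eqI)
  show "sets (distr lborel borel T) = sets lborel" by simp
  fix A assume "A \<in> sets (distr lborel borel T)"
  then have A[measurable]: "A \<in> sets borel" by simp
  interpret linear T by fact
  have T[measurable]: "T \<in> borel_measurable borel"
    by (intro borel_measurable_continuous_onI linear_continuous_on linear_conv_bounded_linear[THEN iffD1] lin)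
  define B where "B = ball (0::'a) 1"
  have [measurable]: "B \<in> sets borel" by (simp add: B_def)
  have TA: "T -` A \<in> sets lborel" using measurable_sets_borel[OF T A] by simp
  have "emeasure lborel (T -` A) * emeasure lborel B
      = (\<integral>\<^sup>+x. indicator (T -` A) x * emeasure lborel B \<partial>lborel)"
    using TA by (subst nn_integral_multc) auto
  also have "\<dots> = (\<integral>\<^sup>+x. indicator A (T x) * (\<integral>\<^sup>+y. indicator B y \<partial>lborel) \<partial>lborel)"
    by (intro nn_integral_cong) (simp split: split_indicator)
  \<comment> \<open>The inner integral over \<open>y\<close> may be shifted by a vector depending on
    \<open>x\<close>; with \<open>- T x\<close>, both factors contain \<open>T x\<close> and react
    to the shift of \<open>x\<close> below.\<close>
  also have "\<dots> = (\<integral>\<^sup>+x. indicator A (T x) * (\<integral>\<^sup>+y. indicator B (- T x + y) \<partial>lborel) \<partial>lborel)"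
    by (rule nn_integral_cong, rule arg_cong2[where f="(*)"], rule refl,
        rule nn_integral_lborel_translation[symmetric]) measurable
  also have "\<dots> = (\<integral>\<^sup>+x. (\<integral>\<^sup>+y. indicator A (T x) * indicator B (- T x + y) \<partial>lborel) \<partial>lborel)"
    by (intro nn_integral_cong nn_integral_cmult[symmetric]) auto
  also have "\<dots> = (\<integral>\<^sup>+y. (\<integral>\<^sup>+x. indicator A (T x) * indicator B (- T x + y) \<partial>lborel) \<partial>lborel)"
    by (rule lborel_pair.Fubini'[symmetric]) measurable
  \<comment> \<open>Shifting \<open>x\<close> by \<open>T y\<close> turns the arguments into
    \<open>T x + y\<close> and \<open>- T x\<close>, because \<open>T\<close> is an involution. As
    \<open>T\<close> preserves norms, \<open>- T x\<close> lies in the ball \<open>B\<close> exactly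
    when \<open>x\<close> does, so \<open>A\<close> is now only translated.\<close>
  also have "\<dots> = (\<integral>\<^sup>+y. (\<integral>\<^sup>+x. indicator A (T (T y + x)) * indicator B (- T (T y + x) + y) \<partial>lborel) \<partial>lborel)"
    by (intro nn_integral_cong nn_integral_lborel_translation[symmetric]) measurable
  also have "\<dots> = (\<integral>\<^sup>+y. (\<integral>\<^sup>+x. indicator A (T x + y) * indicator B x \<partial>lborel) \<partial>lborel)"
    by (intro nn_integral_cong) (auto simp: B_def add inv iso indicator_def algebra_simps)
  also have "\<dots> = (\<integral>\<^sup>+x. (\<integral>\<^sup>+y. indicator A (T x + y) * indicator B x \<partial>lborel) \<partial>lborel)"
    by (rule lborel_pair.Fubini') measurable
  also have "\<dots> = (\<integral>\<^sup>+x. (\<integral>\<^sup>+y. indicator A (T x + y) \<partial>lborel) * indicator B x \<partial>lborel)"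
    by (intro nn_integral_cong nn_integral_multc) auto
  also have "\<dots> = (\<integral>\<^sup>+x. emeasure lborel A * indicator B x \<partial>lborel)"
    by (subst nn_integral_lborel_translation) auto
  also have "\<dots> = emeasure lborel A * emeasure lborel B"
    by (simp add: nn_integral_cmult_indicator)
  finally have eq: "emeasure lborel (T -` A) * emeasure lborel B = emeasure lborel A * emeasure lborel B" .
  have fin: "emeasure lborel B \<noteq> \<infinity>"
    using emeasure_lborel_ball_finite[of "0::'a" 1] by (auto simp: B_def)
  have nz: "emeasure lborel B \<noteq> 0"
    using emeasure_lborel_open_pos[of B] by (simp add: B_def)
  have "emeasure lborel (T -` A) = emeasure lborel A"
    using eq fin nz by (simp add: ennreal_mult_cancel_left mult.commute[of _ "emeasure lborel B"])
  then show "emeasure (distr lborel borel T) A = emeasure lborel A"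
    by (simp add: emeasure_distr)
qed

section \<open>The uniform measure on the sphere\<close>

lemma borel_measurable_normalize [measurable]:
  "(\<lambda>x::'a::euclidean_space. x /\<^sub>R norm x) \<in> borel_measurable borel"
  by measurable

lemma sets_sphere_measure [simp, measurable_cong]: "sets sphere_measure = sets borel"
  by (simp add: sphere_measure_def)

lemma space_sphere_measure [simp]: "space sphere_measure = UNIV"
  by (simp add: sphere_measure_def)

lemma emeasure_sphere_measure:
  fixes A :: "'a::euclidean_space set"
  assumes A[measurable]: "A \<in> sets borel"
  shows "emeasure sphere_measure A =
    emeasure lborel (ball 0 1 \<inter> (\<lambda>x. x /\<^sub>R norm x) -` A) / emeasure lborel (ball (0::'a) 1)"
proof -
  have "(\<lambda>x. x /\<^sub>R norm x) -` A \<in> sets borel"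
    by (rule measurable_sets_borel[OF _ A]) simp
  then show ?thesis
    unfolding sphere_measure_def by (subst emeasure_distr) auto
qed

lemma emeasure_lborel_unit_ball:
  shows "emeasure lborel (ball (0::'a::euclidean_space) 1) \<noteq> 0"
    and "emeasure lborel (ball (0::'a::euclidean_space) 1) \<noteq> \<infinity>"
  using emeasure_lborel_open_pos[of "ball (0::'a) 1"] emeasure_lborel_ball_finite[of "0::'a" 1] by auto

lemma emeasure_sphere_measure_UNIV: "emeasure (sphere_measure :: 'a::euclidean_space measure) UNIV = 1"
  using emeasure_lborel_unit_ball[where 'a='a] by (simp add: emeasure_sphere_measure ennreal_divide_self less_top)

lemma finite_measure_sphere_measure: "finite_measure (sphere_measure :: 'a::euclidean_space measure)"
  by (rule finite_measureI) (simp add: emeasure_sphere_measure_UNIV)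

lemma emeasure_sphere_measure_open_pos:
  fixes U :: "'a::euclidean_space set"
  assumes "open U" "y \<in> U" "norm y = 1"
  shows "emeasure sphere_measure (U \<inter> sphere 0 1) > 0"
proof -
  let ?N = "\<lambda>x::'a. x /\<^sub>R norm x"
  have "continuous_on (- {0}) ?N" by (intro continuous_intros) auto
  then have op: "open (?N -` U \<inter> - {0})"
    using \<open>open U\<close> continuous_open_preimage[of "- {0}" ?N U] by (simp add: Int_commute open_Compl)
  \<comment> \<open>Since \<open>inverse 0 = 0\<close>, the origin is normalized to 0, which is off
    the sphere; deleting it changes nothing and leaves an open preimage.\<close>
  have eq: "ball 0 1 \<inter> ?N -` (U \<inter> sphere 0 1) = ball 0 1 \<inter> (?N -` U \<inter> - {0})"
    by (auto simp: norm_divide split: if_splits)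
  have "y /\<^sub>R 2 \<in> ball 0 1 \<inter> (?N -` U \<inter> - {0})" using assms by auto
  then have "emeasure lborel (ball 0 1 \<inter> (?N -` U \<inter> - {0})) > 0"
    by (intro emeasure_lborel_open_pos open_Int op open_ball) (rule notI, simp only: empty_iff)
  moreover have M: "U \<inter> sphere 0 1 \<in> sets borel" using \<open>open U\<close> by auto
  ultimately show ?thesis
    using emeasure_lborel_unit_ball[where 'a='a]
    unfolding emeasure_sphere_measure[OF M] eq by (simp add: ennreal_zero_less_divide less_top)
qed

text \<open>Radial projection commutes with \<open>T\<close>, and \<open>T\<close> preserves the
  unit ball, so the invariance of Lebesgue measure passes to the push-forward.\<close>

lemma sphere_measure_distr_isometric_involution:
  fixes T :: "'a::euclidean_space \<Rightarrow> 'a"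
  assumes lin: "linear T" and inv: "\<And>x. T (T x) = x" and iso: "\<And>x. norm (T x) = norm x"
  shows "distr sphere_measure borel T = sphere_measure"
proof (rule measure_eqI)
  show "sets (distr sphere_measure borel T) = sets sphere_measure" by simp
  fix A assume "A \<in> sets (distr sphere_measure borel T)"
  then have A: "A \<in> sets borel" by simp
  let ?N = "\<lambda>x::'a. x /\<^sub>R norm x"
  have T[measurable]: "T \<in> borel_measurable borel"
    by (intro borel_measurable_continuous_onI linear_continuous_on linear_conv_bounded_linear[THEN iffD1] lin)
  have TA: "T -` A \<in> sets borel" by (rule measurable_sets_borel[OF T A])
  have NA: "?N -` A \<in> sets borel" by (rule measurable_sets_borel[OF _ A]) simp
  have "ball 0 1 \<inter> ?N -` (T -` A) = T -` (ball 0 1 \<inter> ?N -` A)"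
    using iso by (auto simp: linear_scale[OF lin])
  moreover have "emeasure lborel (T -` (ball 0 1 \<inter> ?N -` A)) = emeasure (distr lborel borel T) (ball 0 1 \<inter> ?N -` A)"
    using NA by (subst emeasure_distr) auto
  ultimately show "emeasure (distr sphere_measure borel T) A = emeasure sphere_measure A"
    using A TA by (simp add: emeasure_distr emeasure_sphere_measure lborel_distr_isometric_involution[OF assms])
qed

text \<open>A nonnegative function with zero integral vanishes almost everywhere, whereas an open
  set meeting the sphere has positive measure there. All strict inequalities between values of
  \<open>psi\<close> rest on this.\<close>

lemma integral_sphere_measure_pos:
  fixes f :: "'a::euclidean_space \<Rightarrow> real"
  assumes f: "integrable sphere_measure f" and nonneg: "\<And>y. 0 \<le> f y"
    and U: "open U" "y \<in> U" "norm y = 1" and pos: "\<And>y. y \<in> U \<Longrightarrow> norm y = 1 \<Longrightarrow> 0 < f y"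
  shows "0 < (\<integral>y. f y \<partial>sphere_measure)"
proof -
  have "(\<integral>y. f y \<partial>sphere_measure) \<noteq> 0"
  proof
    assume "(\<integral>y. f y \<partial>sphere_measure) = 0"
    then have "AE y in sphere_measure. f y = 0"
      using integral_nonneg_eq_0_iff_AE[OF f] nonneg by simp
    then obtain N where N: "{y. f y \<noteq> 0} \<subseteq> N" "N \<in> null_sets sphere_measure"
      by (auto simp: eventually_ae_filter)
    have "U \<inter> sphere 0 1 \<subseteq> N" using pos N by force
    then have "U \<inter> sphere 0 1 \<in> null_sets sphere_measure"
      using U by (intro null_sets_subset[OF N(2)]) auto
    then show False using emeasure_sphere_measure_open_pos[OF U] by auto
  qed
  then show ?thesis using Bochner_Integration.integral_nonneg[of sphere_measure f] nonneg by (simp add: order_less_le)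
qed

section \<open>Distances to the midpoint of a spherical arc\<close>

text \<open>Here \<open>m\<close> is the midpoint of the arc from \<open>u\<close> to
  \<open>v\<close>, and \<open>N\<close> is the length of \<open>u + v\<close>. With \<nu> half the
  difference of the two angles, \<open>N * (m \<bullet> y) = 2 * cos \<nu> * cos \<mu>\<close>, and
  \<open>N \<le> 2 * cos \<nu>\<close> says that these angles differ by at most the angle between
  \<open>u\<close> and \<open>v\<close>. The sign of \<open>cos \<mu>\<close> then decides the
  direction of the inequality.\<close>

lemma arccos_midpoint:
  fixes u v m y :: "'a::real_inner"
  assumes unit: "norm u = 1" "norm v = 1" "norm m = 1" "norm y = 1"
    and N: "N > 0" "u + v = N *\<^sub>R m"
  defines "\<mu> \<equiv> (arccos (u \<bullet> y) + arccos (v \<bullet> y)) / 2"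
  shows "0 \<le> u \<bullet> y \<Longrightarrow> 0 \<le> v \<bullet> y \<Longrightarrow> arccos (m \<bullet> y) \<le> \<mu>"
    and "u \<bullet> y \<le> 0 \<Longrightarrow> v \<bullet> y \<le> 0 \<Longrightarrow> \<mu> \<le> arccos (m \<bullet> y)"
proof -
  have bd: "\<bar>u \<bullet> y\<bar> \<le> 1" "\<bar>v \<bullet> y\<bar> \<le> 1" "\<bar>m \<bullet> y\<bar> \<le> 1"
    using Cauchy_Schwarz_ineq2[of u y] Cauchy_Schwarz_ineq2[of v y] Cauchy_Schwarz_ineq2[of m y] unit by auto
  define \<alpha> \<beta> where "\<alpha> = arccos (u \<bullet> y)" and "\<beta> = arccos (v \<bullet> y)"
  define \<nu> where "\<nu> = (\<alpha> - \<beta>) / 2"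
  then have "2 * \<nu> = \<alpha> - \<beta>" by simp
  have \<mu>: "\<mu> = (\<alpha> + \<beta>) / 2" by (simp add: \<mu>_def \<alpha>_def \<beta>_def)
  have rng: "0 \<le> \<alpha>" "\<alpha> \<le> pi" "0 \<le> \<beta>" "\<beta> \<le> pi"
    unfolding \<alpha>_def \<beta>_def using bd by (auto intro!: arccos_lbound arccos_ubound)
  have cs: "cos \<alpha> = u \<bullet> y" "cos \<beta> = v \<bullet> y" "sin \<alpha> = sqrt (1 - (u \<bullet> y)\<^sup>2)" "sin \<beta> = sqrt (1 - (v \<bullet> y)\<^sup>2)"
    unfolding \<alpha>_def \<beta>_def using bd by (auto simp: sin_arccos_abs)
  have one: "u \<bullet> u = 1" "v \<bullet> v = 1" "y \<bullet> y = 1" "m \<bullet> m = 1"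
    using unit by (simp_all add: dot_square_norm)
  \<comment> \<open>The components of \<open>u\<close> and \<open>v\<close> orthogonal to
    \<open>y\<close> have lengths \<open>sin \<alpha>\<close> and \<open>sin \<beta>\<close>;
    Cauchy-Schwarz for them is the spherical triangle inequality.\<close>
  have "norm (u - (u \<bullet> y) *\<^sub>R y) = sin \<alpha>" "norm (v - (v \<bullet> y) *\<^sub>R y) = sin \<beta>"
    unfolding cs norm_eq_sqrt_inner
    by (simp_all add: inner_diff_left inner_diff_right one inner_commute power2_eq_square)
  moreover have "(u - (u \<bullet> y) *\<^sub>R y) \<bullet> (v - (v \<bullet> y) *\<^sub>R y) = u \<bullet> v - (u \<bullet> y) * (v \<bullet> y)"
    by (simp add: inner_diff_left inner_diff_right one inner_commute)
  ultimately have "u \<bullet> v \<le> cos (\<alpha> - \<beta>)"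
    using norm_cauchy_schwarz[of "u - (u \<bullet> y) *\<^sub>R y" "v - (v \<bullet> y) *\<^sub>R y"] by (simp add: cos_diff cs(1,2))
  also have "cos (\<alpha> - \<beta>) = 2 * (cos \<nu>)\<^sup>2 - 1" 
    using cos_double_cos[of \<nu>] \<open>2 * \<nu> = \<alpha> - \<beta>\<close> by simp
  finally have "2 + 2 * (u \<bullet> v) \<le> (2 * cos \<nu>)\<^sup>2" by (simp add: power_mult_distrib)
  moreover have "N\<^sup>2 = 2 + 2 * (u \<bullet> v)"
  proof -
    have "(u + v) \<bullet> (u + v) = N\<^sup>2" unfolding N(2) by (simp add: one power2_eq_square)
    then show ?thesis by (simp add: inner_add_left inner_add_right one inner_commute)
  qed
  moreover have "cos \<nu> \<ge> 0" using rng by (intro cos_ge_zero) (auto simp: \<nu>_def)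
  ultimately have "N\<^sup>2 \<le> (2 * cos \<nu>)\<^sup>2" "0 \<le> 2 * cos \<nu>" by linarith+
  then have le: "N \<le> 2 * cos \<nu>" by (rule power2_le_imp_le)
  have "N * (m \<bullet> y) = u \<bullet> y + v \<bullet> y"
    using arg_cong[OF N(2), of "\<lambda>x. x \<bullet> y"] by (simp add: inner_add_left)
  also have "\<dots> = 2 * cos \<nu> * cos \<mu>"
    unfolding cs(1,2)[symmetric] cos_plus_cos \<nu>_def \<mu> by simp
  finally have eq: "N * (m \<bullet> y) = 2 * cos \<nu> * cos \<mu>" .
  have \<mu>r: "0 \<le> \<mu>" "\<mu> \<le> pi" using rng by (auto simp: \<mu>)
  {
    assume "0 \<le> u \<bullet> y" "0 \<le> v \<bullet> y"
    then have "\<mu> \<le> pi / 2" using bd arccos_le_pi2[of "u \<bullet> y"] arccos_le_pi2[of "v \<bullet> y"] by (auto simp: \<mu> \<alpha>_def \<beta>_def) 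
    then have "0 \<le> cos \<mu>" using \<mu>r by (intro cos_ge_zero) auto
    then have "N * cos \<mu> \<le> N * (m \<bullet> y)" unfolding eq using le by (intro mult_right_mono) auto
    then have "cos \<mu> \<le> m \<bullet> y" using N(1) by simp
    then have "arccos (m \<bullet> y) \<le> arccos (cos \<mu>)" using bd by (intro arccos_le_arccos) auto
    then show "arccos (m \<bullet> y) \<le> \<mu>" using \<mu>r by (simp add: arccos_cos)
  }
  {
    assume "u \<bullet> y \<le> 0" "v \<bullet> y \<le> 0"
    then have "N * (m \<bullet> y) \<le> 0"
      by (simp add: \<open>N * (m \<bullet> y) = u \<bullet> y + v \<bullet> y\<close>)
    \<comment> \<open>\<open>2 * cos \<nu>\<close> is at least \<open>N\<close>, hence positive, so
      the sign of \<open>m \<bullet> y\<close> carries over to \<open>cos \<mu>\<close>.\<close>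
    then have "cos \<mu> \<le> 0" using le N(1) unfolding eq by (auto simp: mult_le_0_iff)
    then have "N * (m \<bullet> y) \<le> N * cos \<mu>" unfolding eq using le by (intro mult_right_mono_neg) auto
    then have "m \<bullet> y \<le> cos \<mu>" using N(1) by simp
    then have "arccos (cos \<mu>) \<le> arccos (m \<bullet> y)" using bd by (intro arccos_le_arccos) auto
    then show "\<mu> \<le> arccos (m \<bullet> y)" using \<mu>r by (simp add: arccos_cos)
  }
qed

section \<open>Minimum points on the sphere and small perturbations\<close>

lemma sphere_global_min_imp_local_min: "sphere_global_min f w \<Longrightarrow> sphere_local_min f w"
  unfolding sphere_global_min_def sphere_local_min_def by (auto intro: exI[of _ 1])

lemma sphere_local_min_eventually:
  assumes "sphere_local_min f w" "(c \<longlongrightarrow> w) F" "eventually (\<lambda>t. norm (c t) = 1) F"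
  shows "eventually (\<lambda>t. f w \<le> f (c t)) F"
proof -
  obtain e where e: "e > 0" "\<And>v. norm v = 1 \<Longrightarrow> dist v w < e \<Longrightarrow> f w \<le> f v"
    using assms(1) by (auto simp: sphere_local_min_def)
  show ?thesis
    using tendstoD[OF assms(2) e(1)] assms(3) by eventually_elim (use e in auto)
qed

text \<open>A point moved in an ambient direction and normalized back stays near \<open>w\<close> on
  the sphere. Later contradictions come from a small positive \<open>t\<close> for which such a move
  lowers the potential.\<close>

lemma sphere_local_min_perturb:
  assumes w: "sphere_local_min f w"
  shows "eventually (\<lambda>t. f w \<le> f (sgn (w + t *\<^sub>R a))) (at_right 0)"
proof (rule sphere_local_min_eventually[OF w])
  have nw: "norm w = 1" using w by (simp add: sphere_local_min_def)
  then have "w \<noteq> 0" by auto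
  have lim: "((\<lambda>t. w + t *\<^sub>R a) \<longlongrightarrow> w + 0 *\<^sub>R a) (at_right 0)" by (intro tendsto_intros)
  then show "((\<lambda>t. sgn (w + t *\<^sub>R a)) \<longlongrightarrow> w) (at_right 0)"
    using tendsto_sgn[OF lim] \<open>w \<noteq> 0\<close> nw by (simp add: sgn_div_norm)
  show "eventually (\<lambda>t. norm (sgn (w + t *\<^sub>R a)) = 1) (at_right 0)"
    using tendsto_imp_eventually_ne[OF lim, of 0] \<open>w \<noteq> 0\<close> by (auto simp: norm_sgn elim: eventually_mono)
qed

lemma abs_inner_unit: "norm w = 1 \<Longrightarrow> norm y = 1 \<Longrightarrow> \<bar>w \<bullet> y\<bar> \<le> (1::real)"
  using Cauchy_Schwarz_ineq2[of w y] by simp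

lemma inner_sgn_left: "sgn x \<bullet> y = (x \<bullet> y) / norm x"
  by (simp add: sgn_div_norm divide_inverse mult.commute)

section \<open>Geometry of the cone\<close>

locale cone_potential =
  fixes K :: "'a::euclidean_space set" and g :: "real \<Rightarrow> real"
  assumes closed_K: "closed K" and cone_K: "convex_cone K" and proper_K: "proper_cone K"
    and interior_K: "interior K \<noteq> {}"
    and g_cont: "continuous_on {0..pi} g" and g_mono: "strict_mono_on {0..pi} g"
    and g_convex: "convex_on {0..pi/2} g" and g_concave: "concave_on {pi/2..pi} g"
begin

text \<open>Passing from angles to inner products turns comparisons of distances into linear
  inequalities, since \<open>h\<close> is strictly decreasing on [-1, 1].\<close>

definition h :: "real \<Rightarrow> real" where "h x = g (arccos x)"

lemma h_less: "-1 \<le> x \<Longrightarrow> x < y \<Longrightarrow> y \<le> 1 \<Longrightarrow> h y < h x"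
  unfolding h_def
  by (intro strict_mono_onD[OF g_mono]) (auto intro: arccos_less_arccos arccos_lbound arccos_ubound)

lemma h_le: "-1 \<le> x \<Longrightarrow> x \<le> y \<Longrightarrow> y \<le> 1 \<Longrightarrow> h y \<le> h x"
  using h_less[of x y] by (cases "x = y") auto

lemma h_cont: "continuous_on {-1..1} h"
  unfolding h_def
  by (rule continuous_on_compose2[OF g_cont]) (auto intro!: continuous_on_arccos' arccos_lbound arccos_ubound)

lemma K_add: "x \<in> K \<Longrightarrow> y \<in> K \<Longrightarrow> x + y \<in> K"
  using cone_K by (rule convex_cone_add)

lemma K_scale: "x \<in> K \<Longrightarrow> 0 \<le> c \<Longrightarrow> c *\<^sub>R x \<in> K"
  using cone_K by (simp add: convex_cone_scaleR)

lemma K_interior: "x \<in> interior K \<Longrightarrow> x \<in> K"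
  using interior_subset by blast

lemma interior_add:
  assumes "x \<in> interior K" "y \<in> K"
  shows "x + y \<in> interior K"
proof (rule interior_maximal[THEN subsetD])
  show "(+) y ` interior K \<subseteq> K" using assms(2) K_add K_interior by auto
  show "open ((+) y ` interior K)" by (intro open_translation) auto
  show "x + y \<in> (+) y ` interior K" using assms by (auto simp: add.commute)
qed

lemma interior_scale:
  assumes "x \<in> interior K" "0 < c"
  shows "c *\<^sub>R x \<in> interior K"
proof (rule interior_maximal[THEN subsetD])
  show "(*\<^sub>R) c ` interior K \<subseteq> K" using assms(2) K_scale K_interior by auto
  show "open ((*\<^sub>R) c ` interior K)" using assms by (intro open_scaling) auto
  show "c *\<^sub>R x \<in> (*\<^sub>R) c ` interior K" using assms by auto
qed

text \<open>Properness enters here: a neighbourhood of 0 inside \<open>K\<close> would contain a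
  negative multiple of the normal of a halfspace containing \<open>K\<close>.\<close>

lemma zero_notin_interior: "0 \<notin> interior K"
proof
  assume "0 \<in> interior K"
  then obtain e where e: "e > 0" "ball 0 e \<subseteq> K" by (auto simp: mem_interior)
  obtain a where a: "a \<noteq> 0" "\<And>x. x \<in> K \<Longrightarrow> 0 \<le> a \<bullet> x" using proper_K by (auto simp: proper_cone_def)
  have "(- (e / (2 * norm a))) *\<^sub>R a \<in> K" using e a(1) by (intro subsetD[OF e(2)]) auto
  then have "0 \<le> - (e / (2 * norm a)) * (a \<bullet> a)" using a(2) by fastforce
  moreover have "e / (2 * norm a) * (a \<bullet> a) > 0" using e a(1) by auto
  ultimately show False by linarith
qed

lemma uminus_interior_notin: "x \<in> interior K \<Longrightarrow> - x \<notin> K"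
  using interior_add[of x "- x"] zero_notin_interior by auto

text \<open>A small step from \<open>y\<close> in the direction \<open>- w\<close> stays in
  \<open>K\<close>, where the inner product with \<open>w\<close> is still nonnegative although the
  step has lowered it.\<close>

lemma inner_interior_pos:
  assumes "\<And>y. y \<in> K \<Longrightarrow> 0 \<le> w \<bullet> y" "w \<noteq> 0" "y \<in> interior K"
  shows "0 < w \<bullet> y"
proof -
  obtain e where e: "e > 0" "ball y e \<subseteq> K" using assms(3) by (auto simp: mem_interior)
  have "y - (e / (2 * norm w)) *\<^sub>R w \<in> K" using e assms(2) by (intro subsetD[OF e(2)]) (auto simp: dist_norm)
  from assms(1)[OF this] have "(e / (2 * norm w)) * (w \<bullet> w) \<le> w \<bullet> y" by (simp add: inner_diff_right)
  moreover have "(e / (2 * norm w)) * (w \<bullet> w) > 0" using e assms(2) by auto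
  ultimately show ?thesis by linarith
qed

lemma separate_from_K:
  assumes "w \<notin> K"
  obtains a where "\<And>y. y \<in> K \<Longrightarrow> 0 \<le> a \<bullet> y" "a \<bullet> w < 0"
proof -
  have "convex K" using cone_K by (simp add: convex_cone_def)
  then obtain a b where ab: "a \<bullet> w < b" "\<And>x. x \<in> K \<Longrightarrow> b < a \<bullet> x"
    using separating_hyperplane_closed_point[of K w] closed_K assms by blast
  have "b < 0" using ab(2)[of 0] convex_cone_contains_0[OF cone_K] by simp
  show thesis
  proof (rule that)
    show "a \<bullet> w < 0" using ab \<open>b < 0\<close> by simp
    fix y assume y: "y \<in> K"
    show "0 \<le> a \<bullet> y"
    proof (rule ccontr)
      assume "\<not> 0 \<le> a \<bullet> y"
      then have neg: "a \<bullet> y < 0" by simp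
      \<comment> \<open>This multiple of \<open>y\<close> has inner product exactly \<open>b\<close>
        with \<open>a\<close>, so it lies on the separating hyperplane, which \<open>K\<close> must
        not meet.\<close>
      with \<open>b < 0\<close> have "(b / (a \<bullet> y)) *\<^sub>R y \<in> K" by (intro K_scale y) (auto simp: divide_nonpos_neg)
      from ab(2)[OF this] neg show False by simp
    qed
  qed
qed

section \<open>The spherical section of the cone and integration over it\<close>

definition K1 :: "'a set" where "K1 = K \<inter> sphere 0 1"

lemma compact_K1: "compact K1"
  unfolding K1_def using closed_K by (simp add: closed_Int_compact)

lemma K1_D: "y \<in> K1 \<Longrightarrow> y \<in> K" "y \<in> K1 \<Longrightarrow> norm y = 1"
  by (auto simp: K1_def)

lemma interior_normalize:
  assumes "x \<in> interior K"
  shows "sgn x \<in> interior K" "sgn x \<in> K1"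
proof -
  have "x \<noteq> 0" using assms zero_notin_interior by auto
  then show "sgn x \<in> interior K" using interior_scale[OF assms, of "inverse (norm x)"] by (simp add: sgn_div_norm)
  then show "sgn x \<in> K1" using \<open>x \<noteq> 0\<close> K_interior by (auto simp: K1_def norm_sgn)
qed

text \<open>A point of \<open>K1\<close> may lie on the boundary of \<open>K\<close>; tilting it
  slightly towards an interior point \<open>p\<close> and normalizing gives interior unit vectors
  arbitrarily close to it.\<close>

lemma K1_near_interior:
  assumes "y \<in> K1" "open V" "y \<in> V"
  obtains z where "z \<in> V" "z \<in> interior K" "norm z = 1"
proof -
  obtain p where p: "p \<in> interior K" using interior_K by auto
  have y: "norm y = 1" "y \<noteq> 0" "y \<in> K" using K1_D[OF assms(1)] by auto
  have lim: "((\<lambda>t. y + t *\<^sub>R p) \<longlongrightarrow> y + 0 *\<^sub>R p) (at_right 0)" by (intro tendsto_intros)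
  have "((\<lambda>t. sgn (y + t *\<^sub>R p)) \<longlongrightarrow> y) (at_right 0)"
    using tendsto_sgn[OF lim] y by (simp add: sgn_div_norm)
  then have "eventually (\<lambda>t. sgn (y + t *\<^sub>R p) \<in> V) (at_right 0)"
    using assms by (simp add: topological_tendstoD)
  with eventually_at_right_less[of "0::real"] have "eventually (\<lambda>t. 0 < t \<and> sgn (y + t *\<^sub>R p) \<in> V) (at_right 0)"
    by eventually_elim auto
  then obtain t where t: "0 < t" "sgn (y + t *\<^sub>R p) \<in> V"
    using eventually_happens'[of "at_right (0::real)"] by auto
  have "y + t *\<^sub>R p \<in> interior K" using interior_add[OF interior_scale[OF p t(1)] y(3)] by (simp add: add.commute)
  from interior_normalize[OF this] t show thesis by (intro that) (auto simp: K1_def)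
qed

abbreviation K1_integral :: "('a \<Rightarrow> real) \<Rightarrow> real" where
  "K1_integral f \<equiv> (LINT y : K1 | sphere_measure. f y)"

lemma K1_integrable:
  assumes "continuous_on K1 f"
  shows "set_integrable sphere_measure K1 (f :: 'a \<Rightarrow> real)"
proof -
  interpret finite_measure "sphere_measure :: 'a measure" by (rule finite_measure_sphere_measure)
  have "bounded (f ` K1)" using compact_continuous_image[OF assms compact_K1] by (rule compact_imp_bounded)
  then obtain B where B: "0 < B" "\<And>y. y \<in> K1 \<Longrightarrow> norm (f y) \<le> B" by (auto simp: bounded_pos)
  have [measurable]: "K1 \<in> sets borel" using compact_K1 by (simp add: borel_compact)
  have "(\<lambda>y. indicator K1 y *\<^sub>R f y) \<in> borel_measurable borel"
    by (rule borel_measurable_continuous_on_indicator) (use assms in auto)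
  then show ?thesis unfolding set_integrable_def
    by (intro integrable_const_bound[of _ B]) (use B in \<open>auto split: split_indicator\<close>)
qed

text \<open>By continuity the strict inequality at one point spreads to a relative neighbourhood in
  \<open>K1\<close>. That neighbourhood contains interior unit vectors of \<open>K\<close>, hence a
  set of positive measure.\<close>

lemma K1_integral_less:
  assumes f: "continuous_on K1 f1" "continuous_on K1 f2"
    and le: "\<And>y. y \<in> K1 \<Longrightarrow> f1 y \<le> f2 y" and y: "y \<in> K1" "f1 y < f2 y"
  shows "K1_integral f1 < K1_integral f2"
proof -
  have cont: "continuous_on K1 (\<lambda>y. f2 y - f1 y)" by (intro continuous_intros f)
  then obtain V where V: "open V" "V \<inter> K1 = (\<lambda>y. f2 y - f1 y) -` {0<..} \<inter> K1"
    unfolding continuous_on_open_invariant by (metis open_greaterThan)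
  have "y \<in> V" using V(2) y by auto
  then obtain z where z: "z \<in> V" "z \<in> interior K" "norm z = 1"
    using K1_near_interior[OF y(1) V(1)] by blast
  have "0 < (\<integral>y. indicator K1 y *\<^sub>R (f2 y - f1 y) \<partial>sphere_measure)"
  proof (rule integral_sphere_measure_pos)
    show "integrable sphere_measure (\<lambda>y. indicator K1 y *\<^sub>R (f2 y - f1 y))"
      using K1_integrable[OF cont] by (simp add: set_integrable_def)
    show "open (V \<inter> interior K)" using V by auto
    show "z \<in> V \<inter> interior K" "norm z = 1" using z by auto
    show "0 \<le> indicator K1 y *\<^sub>R (f2 y - f1 y)" for y using le by (auto split: split_indicator)
    fix x assume x: "x \<in> V \<inter> interior K" "norm x = 1"
    then have "x \<in> K1" by (auto simp: K1_def K_interior)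
    moreover from this have "0 < f2 x - f1 x" using V(2) x by auto
    ultimately show "0 < indicator K1 x *\<^sub>R (f2 x - f1 x)" by simp
  qed
  also have "\<dots> = K1_integral (\<lambda>y. f2 y - f1 y)" by (simp add: set_lebesgue_integral_def)
  also have "\<dots> = K1_integral f2 - K1_integral f1"
    by (intro set_integral_diff K1_integrable f)
  finally show ?thesis by simp
qed

section \<open>Comparison of values of the potential, and reflections\<close>

lemma psi_eq: "psi K g w = K1_integral (\<lambda>y. h (w \<bullet> y))"
  by (simp add: psi_def K1_def h_def geod_def)

lemma inner_K1:
  assumes "norm w = 1" "y \<in> K1" shows "-1 \<le> w \<bullet> y" "w \<bullet> y \<le> 1"
  using abs_inner_unit[OF assms(1) K1_D(2)[OF assms(2)]] by auto

lemma cont_K1: "norm w = 1 \<Longrightarrow> continuous_on K1 (\<lambda>y. h (w \<bullet> y))"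
  by (rule continuous_on_compose2[OF h_cont]) (auto intro!: continuous_intros inner_K1)

lemma psi_less:
  assumes "norm u = 1" "norm v = 1" "\<And>y. y \<in> K1 \<Longrightarrow> v \<bullet> y \<le> u \<bullet> y" "y \<in> K1" "v \<bullet> y < u \<bullet> y"
  shows "psi K g u < psi K g v"
  unfolding psi_eq by (rule K1_integral_less[OF _ _ _ assms(4)])
    (use assms inner_K1 in \<open>auto intro!: cont_K1 h_le h_less\<close>)

text \<open>The difference \<open>D\<close> of the two integrands is odd under the reflection
  \<open>T\<close> and positive where \<open>0 < y \<bullet> q\<close>. Adding the integrand of
  \<open>D\<close> over \<open>K1\<close> to its reflected copy gives \<open>D y\<close> times the
  difference of the indicators of \<open>K1\<close> at \<open>y\<close> and at \<open>T y\<close>.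
  On the positive side this difference is nonnegative, because the cone grows towards
  \<open>q\<close>.\<close>

lemma psi_reflect_less:
  assumes q: "q \<in> interior K" and w: "norm w = 1" "w \<bullet> q < 0"
  shows "psi K g (w - (2 * (w \<bullet> q) / (q \<bullet> q)) *\<^sub>R q) < psi K g w"
proof -
  define T where "T y = y - (2 * (y \<bullet> q) / (q \<bullet> q)) *\<^sub>R q" for y
  have q0: "q \<bullet> q > 0" using q zero_notin_interior by auto
  have lin: "linear T"
    by (rule linearI) (simp_all add: T_def inner_add_left algebra_simps add_divide_distrib)
  have Tq: "T y \<bullet> q = - (y \<bullet> q)" for y using q0 by (simp add: T_def inner_diff_left)
  have inv: "T (T y) = y" for y
    unfolding T_def[of "T y"] Tq by (simp add: T_def)
  have sym: "T x \<bullet> y = x \<bullet> T y" for x y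
    by (simp add: T_def inner_diff_left inner_diff_right inner_commute)
  have iso: "norm (T y) = norm y" for y
    unfolding norm_eq_sqrt_inner sym inv ..
  have TK: "y \<in> K1" if "T y \<in> K1" "0 \<le> y \<bullet> q" for y
  proof -
    \<comment> \<open>The left side is \<open>y\<close> itself: it arises from \<open>T y\<close> by
      adding a nonnegative multiple of \<open>q\<close>.\<close>
    have "T y + (2 * (y \<bullet> q) / (q \<bullet> q)) *\<^sub>R q \<in> K"
      using that q0 K1_D(1)[OF that(1)] by (intro K_add K_scale K_interior[OF q]) auto
    then show ?thesis using that(1) by (simp add: T_def K1_def) (metis T_def iso)
  qed
  define D where "D y = h (w \<bullet> y) - h (T w \<bullet> y)" for y
  have DT: "D (T y) = - D y" for y by (simp add: D_def sym inv)
  have nTw: "norm (T w) = 1" using w iso by simp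
  have "T w \<bullet> y = w \<bullet> y + (- 2 * (w \<bullet> q) / (q \<bullet> q)) * (y \<bullet> q)" for y
    by (simp add: T_def inner_diff_left inner_commute[of q y])
  moreover have "- 2 * (w \<bullet> q) / (q \<bullet> q) > 0" using w q0 by (simp add: divide_neg_pos)
  ultimately obtain c where c: "c > 0" "\<And>y. T w \<bullet> y = w \<bullet> y + c * (y \<bullet> q)" by blast
  have bd: "-1 \<le> w \<bullet> y" "T w \<bullet> y \<le> 1" if "norm y = 1" for y
    using abs_inner_unit[OF w(1) that] abs_inner_unit[OF nTw that] by auto
  have Dpos: "0 < D y" if "norm y = 1" "0 < y \<bullet> q" for y
    using h_less[of "w \<bullet> y" "T w \<bullet> y"] bd[OF that(1)] c that by (simp add: D_def)
  have Dz: "D y = 0" if "y \<bullet> q = 0" for y using c(2)[of y] that by (simp add: D_def)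
  let ?I = "\<lambda>y. indicator K1 y * D y"
  have contD: "continuous_on K1 D" unfolding D_def by (intro continuous_intros cont_K1 w nTw)
  have int: "integrable sphere_measure ?I"
    using K1_integrable[OF contD] by (simp add: set_integrable_def)
  have [measurable]: "T \<in> borel_measurable borel"
    by (intro borel_measurable_continuous_onI linear_continuous_on linear_conv_bounded_linear[THEN iffD1] lin)
  have distr: "distr sphere_measure borel T = sphere_measure"
    by (rule sphere_measure_distr_isometric_involution[OF lin inv iso])
  have "integrable (distr sphere_measure borel T) ?I" using int by (simp add: distr)
  then have intT: "integrable sphere_measure (\<lambda>y. ?I (T y))"
    by (rule integrable_distr[rotated]) simp
  have "(\<integral>y. ?I y \<partial>sphere_measure) = (\<integral>y. ?I y \<partial>distr sphere_measure borel T)" by (simp add: distr)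
  also have "\<dots> = (\<integral>y. ?I (T y) \<partial>sphere_measure)"
    using borel_measurable_integrable[OF int] by (intro integral_distr) auto
  finally have eq: "(\<integral>y. ?I y \<partial>sphere_measure) = (\<integral>y. ?I (T y) \<partial>sphere_measure)" .
  have "0 < (\<integral>y. ?I y + ?I (T y) \<partial>sphere_measure)"
  proof (rule integral_sphere_measure_pos)
    show "integrable sphere_measure (\<lambda>y. ?I y + ?I (T y))" using int intT by simp
    show "0 \<le> ?I y + ?I (T y)" for y
    proof (cases "norm y = 1")
      case False
      then show ?thesis by (simp add: K1_def iso)
    next
      case n: True
      \<comment> \<open>The sum is symmetric under \<open>T\<close>, so a point on the negative side
        is handled through its mirror image.\<close>
      consider "y \<bullet> q = 0" | "0 < y \<bullet> q" | "0 < T y \<bullet> q" by (force simp: Tq)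
      then show ?thesis
      proof cases
        case 1 then show ?thesis by (simp add: Dz DT)
      next
        case 2
        with Dpos[OF n] TK[of y] show ?thesis by (auto simp: DT split: split_indicator)
      next
        case 3
        with Dpos[of "T y"] n TK[of "T y"] show ?thesis by (auto simp: DT inv iso split: split_indicator)
      qed
    qed
    \<comment> \<open>Strictness comes from directions near \<open>q\<close>: such \<open>y\<close>
      lie in \<open>K\<close>, while \<open>T y\<close> is close to \<open>- sgn q\<close> and lies
      outside.\<close>
    let ?U = "interior K \<inter> {y. 0 < y \<bullet> q} \<inter> - (T -` K)"
    have "continuous_on UNIV T" by (simp add: lin linear_continuous_on linear_conv_bounded_linear[symmetric])
    then have "closed (T -` K)" using closed_K by (rule closed_vimage[rotated])
    then have "open (- (T -` K))" by (rule open_Compl)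
    moreover have "open {y. 0 < y \<bullet> q}" by (intro open_Collect_less continuous_intros)
    ultimately show "open ?U" by (intro open_Int open_interior)
    have "T q = - q" using q0 by (simp add: T_def scaleR_2)
    then have "T (sgn q) = - sgn q" by (simp add: sgn_div_norm linear_scale[OF lin])
    then show "sgn q \<in> ?U"
      using interior_normalize[OF q] uminus_interior_notin[of "sgn q"] q0 by (auto simp: inner_sgn_left)
    show "norm (sgn q) = 1" using q0 by (auto simp: norm_sgn)
    fix y assume y: "y \<in> ?U" "norm y = 1"
    then have "y \<in> K1" "T y \<notin> K1" by (auto simp: K1_def K_interior)
    then show "0 < ?I y + ?I (T y)" using Dpos y by simp
  qed
  \<comment> \<open>Both summands have the same integral, so the positive quantity is twice the
    integral of \<open>?I\<close>.\<close>
  then have "0 < (\<integral>y. ?I y \<partial>sphere_measure)" using eq int intT by simp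
  also have "\<dots> = psi K g w - psi K g (T w)"
    unfolding psi_eq D_def
    by (subst set_integral_diff(2)[symmetric])
      (auto intro!: K1_integrable cont_K1 w nTw simp: set_lebesgue_integral_def)
  finally show ?thesis by (simp add: T_def)
qed

section \<open>Midpoint convexity and concavity of the potential\<close>

text \<open>For nonnegative inner products both angles are at most pi/2, where \<open>g\<close> is
  convex; for nonpositive ones they are at least pi/2, where it is concave. Monotonicity of
  \<open>g\<close> then replaces the mean angle by the angle at \<open>m\<close>, in the direction
  given by \<open>arccos_midpoint\<close>.\<close>

lemma h_midpoint:
  assumes unit: "norm u = 1" "norm v = 1" "norm m = 1" "norm y = 1"
    and N: "N > 0" "u + v = N *\<^sub>R m"
  shows "0 \<le> u \<bullet> y \<Longrightarrow> 0 \<le> v \<bullet> y \<Longrightarrow> 2 * h (m \<bullet> y) \<le> h (u \<bullet> y) + h (v \<bullet> y)"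
    and "u \<bullet> y \<le> 0 \<Longrightarrow> v \<bullet> y \<le> 0 \<Longrightarrow> h (u \<bullet> y) + h (v \<bullet> y) \<le> 2 * h (m \<bullet> y)"
proof -
  let ?\<alpha> = "arccos (u \<bullet> y)" and ?\<beta> = "arccos (v \<bullet> y)" and ?\<gamma> = "arccos (m \<bullet> y)"
  note bd = abs_inner_unit[OF unit(1,4)] abs_inner_unit[OF unit(2,4)] abs_inner_unit[OF unit(3,4)]
  have rng: "0 \<le> ?\<alpha>" "?\<alpha> \<le> pi" "0 \<le> ?\<beta>" "?\<beta> \<le> pi" "0 \<le> ?\<gamma>" "?\<gamma> \<le> pi"
    using bd by (auto intro!: arccos_lbound arccos_ubound)
  have mono: "g s \<le> g t" if "0 \<le> s" "s \<le> t" "t \<le> pi" for s t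
    using strict_mono_onD[OF g_mono, of s t] that by (cases "s = t") auto
  {
    assume pos: "0 \<le> u \<bullet> y" "0 \<le> v \<bullet> y"
    have "?\<alpha> \<le> pi / 2" "?\<beta> \<le> pi / 2" using bd pos arccos_le_pi2[of "u \<bullet> y"] arccos_le_pi2[of "v \<bullet> y"] by auto
    then have "g ((1 - 1/2) *\<^sub>R ?\<alpha> + (1/2) *\<^sub>R ?\<beta>) \<le> (1 - 1/2) * g ?\<alpha> + 1/2 * g ?\<beta>"
      using rng by (intro convex_onD[OF g_convex]) auto
    moreover have "g ?\<gamma> \<le> g ((?\<alpha> + ?\<beta>) / 2)"
      using arccos_midpoint(1)[OF unit N pos] rng by (intro mono) auto
    ultimately show "2 * h (m \<bullet> y) \<le> h (u \<bullet> y) + h (v \<bullet> y)"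
      by (simp add: h_def add_divide_distrib)
  }
  {
    assume neg: "u \<bullet> y \<le> 0" "v \<bullet> y \<le> 0"
    have "arccos 0 \<le> ?\<alpha>" "arccos 0 \<le> ?\<beta>" 
      using bd neg arccos_le_arccos[of "u \<bullet> y" 0] arccos_le_arccos[of "v \<bullet> y" 0] by auto
    then have "(1 - 1/2) * g ?\<alpha> + 1/2 * g ?\<beta> \<le> g ((1 - 1/2) *\<^sub>R ?\<alpha> + (1/2) *\<^sub>R ?\<beta>)"
      using rng convex_onD[OF g_concave[unfolded concave_on_def], of "1/2" ?\<alpha> ?\<beta>] by simp
    moreover have "g ((?\<alpha> + ?\<beta>) / 2) \<le> g ?\<gamma>"
      using arccos_midpoint(2)[OF unit N neg] rng by (intro mono) auto
    ultimately show "h (u \<bullet> y) + h (v \<bullet> y) \<le> 2 * h (m \<bullet> y)"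
      by (simp add: h_def add_divide_distrib)
  }
qed

lemma K1_integral_h_add:
  assumes "norm u = 1" "norm v = 1"
  shows "K1_integral (\<lambda>y. h (u \<bullet> y) + h (v \<bullet> y)) = psi K g u + psi K g v"
    and "continuous_on K1 (\<lambda>y. h (u \<bullet> y) + h (v \<bullet> y))"
  unfolding psi_eq
  by (intro set_integral_add K1_integrable continuous_on_add cont_K1 assms)+

lemma psi_midpoint_le:
  assumes unit: "norm u = 1" "norm v = 1" "norm m = 1"
    and N: "N > 0" "u + v = N *\<^sub>R m"
    and dual: "\<And>y. y \<in> K \<Longrightarrow> 0 \<le> u \<bullet> y" "\<And>y. y \<in> K \<Longrightarrow> 0 \<le> v \<bullet> y"
  shows "2 * psi K g m \<le> psi K g u + psi K g v"
proof -
  have "K1_integral (\<lambda>y. h (m \<bullet> y) + h (m \<bullet> y)) \<le> K1_integral (\<lambda>y. h (u \<bullet> y) + h (v \<bullet> y))"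
    using h_midpoint(1)[OF unit _ N] dual K1_D
    by (intro set_integral_mono K1_integrable K1_integral_h_add unit) (simp flip: mult_2)
  then show ?thesis 
      using K1_integral_h_add(1)[OF unit(1,2)] K1_integral_h_add(1)[OF unit(3,3)] by linarith
qed

text \<open>The pointwise inequality becomes strict at \<open>y = m\<close>, respectively
  \<open>y = - m\<close>: there \<open>h (m \<bullet> y)\<close> is the minimum \<open>h 1\<close>,
  respectively the maximum \<open>h (-1)\<close>, and at least one of \<open>u\<close>,
  \<open>v\<close> differs from \<open>m\<close>.\<close>

lemma psi_midpoint_less:
  assumes unit: "norm u = 1" "norm v = 1" "norm m = 1" and uv: "u \<noteq> v"
    and N: "N > 0" "u + v = N *\<^sub>R m"
  shows "m \<in> K \<Longrightarrow> (\<And>y. y \<in> K \<Longrightarrow> 0 \<le> u \<bullet> y) \<Longrightarrow> (\<And>y. y \<in> K \<Longrightarrow> 0 \<le> v \<bullet> y) \<Longrightarrow>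
      2 * psi K g m < psi K g u + psi K g v"
    and "- m \<in> K \<Longrightarrow> (\<And>y. y \<in> K \<Longrightarrow> u \<bullet> y \<le> 0) \<Longrightarrow> (\<And>y. y \<in> K \<Longrightarrow> v \<bullet> y \<le> 0) \<Longrightarrow>
      psi K g u + psi K g v < 2 * psi K g m"
proof -
  have one: "m \<bullet> m = 1" "u \<bullet> u = 1" "v \<bullet> v = 1" using unit by (simp_all add: dot_square_norm)
  have less: "x \<bullet> m < 1" if "norm x = 1" "x \<noteq> m" for x
  proof -
    have "(x - m) \<bullet> (x - m) > 0" using that unfolding inner_gt_zero_iff by simp
    moreover have "x \<bullet> x = 1" using that by (simp add: dot_square_norm)
    ultimately show ?thesis using one(1) by (simp add: inner_diff_left inner_diff_right inner_commute[of m x])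
  qed
  have ne: "u \<noteq> m \<or> v \<noteq> m" using uv by auto
  have bd: "u \<bullet> m \<le> 1" "v \<bullet> m \<le> 1" "-1 \<le> u \<bullet> m" "-1 \<le> v \<bullet> m"
    using abs_inner_unit[OF unit(1,3)] abs_inner_unit[OF unit(2,3)] by auto
  {
    assume mK: "m \<in> K" and dual: "\<And>y. y \<in> K \<Longrightarrow> 0 \<le> u \<bullet> y" "\<And>y. y \<in> K \<Longrightarrow> 0 \<le> v \<bullet> y"
    have "K1_integral (\<lambda>y. h (m \<bullet> y) + h (m \<bullet> y)) < K1_integral (\<lambda>y. h (u \<bullet> y) + h (v \<bullet> y))"
    proof (rule K1_integral_less)
      show "h (m \<bullet> y) + h (m \<bullet> y) \<le> h (u \<bullet> y) + h (v \<bullet> y)" if "y \<in> K1" for y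
        using h_midpoint(1)[OF unit _ N] dual K1_D[OF that] by simp
      show "m \<in> K1" using mK unit by (simp add: K1_def)
      show "h (m \<bullet> m) + h (m \<bullet> m) < h (u \<bullet> m) + h (v \<bullet> m)"
        using ne less[OF unit(1)] less[OF unit(2)] h_less[of "u \<bullet> m" 1] h_less[of "v \<bullet> m" 1]
          h_le[of "u \<bullet> m" 1] h_le[of "v \<bullet> m" 1] bd one by fastforce
    qed (intro K1_integral_h_add unit)+
    then show "2 * psi K g m < psi K g u + psi K g v" 
      using K1_integral_h_add(1)[OF unit(1,2)] K1_integral_h_add(1)[OF unit(3,3)] by linarith
  }
  {
    assume mK: "- m \<in> K" and dual: "\<And>y. y \<in> K \<Longrightarrow> u \<bullet> y \<le> 0" "\<And>y. y \<in> K \<Longrightarrow> v \<bullet> y \<le> 0"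
    have "K1_integral (\<lambda>y. h (u \<bullet> y) + h (v \<bullet> y)) < K1_integral (\<lambda>y. h (m \<bullet> y) + h (m \<bullet> y))"
    proof (rule K1_integral_less)
      show "h (u \<bullet> y) + h (v \<bullet> y) \<le> h (m \<bullet> y) + h (m \<bullet> y)" if "y \<in> K1" for y
        using h_midpoint(2)[OF unit _ N] dual K1_D[OF that] by simp
      show "- m \<in> K1" using mK unit by (simp add: K1_def)
      show "h (u \<bullet> - m) + h (v \<bullet> - m) < h (m \<bullet> - m) + h (m \<bullet> - m)"
        using ne less[OF unit(1)] less[OF unit(2)] h_less[of "-1" "- (u \<bullet> m)"] h_less[of "-1" "- (v \<bullet> m)"]
          h_le[of "-1" "- (u \<bullet> m)"] h_le[of "-1" "- (v \<bullet> m)"] bd one by fastforce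
    qed (intro K1_integral_h_add unit)+
    then show "psi K g u + psi K g v < 2 * psi K g m" 
      using K1_integral_h_add(1)[OF unit(1,2)] K1_integral_h_add(1)[OF unit(3,3)] by linarith
  }
qed

section \<open>Continuity of the potential and existence of a minimum point\<close>

text \<open>For unit \<open>y\<close> the inner products with \<open>v\<close> and \<open>w\<close>
  differ by at most \<open>dist v w\<close>, so uniform continuity of \<open>h\<close> bounds the
  integrand uniformly, and the total mass is 1.\<close>

lemma psi_continuous: "continuous_on (sphere 0 1) (psi K g)"
proof (unfold continuous_on_iff, intro ballI allI impI)
  fix w :: 'a and e :: real assume w: "w \<in> sphere 0 1" and e: "e > 0"
  interpret finite_measure "sphere_measure :: 'a measure" by (rule finite_measure_sphere_measure)
  have "uniformly_continuous_on {-1..1} h" by (rule compact_uniformly_continuous[OF h_cont]) simp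
  then obtain d where d: "d > 0" "\<And>s t. s \<in> {-1..1} \<Longrightarrow> t \<in> {-1..1} \<Longrightarrow> dist s t < d \<Longrightarrow> dist (h s) (h t) < e / 2"
    using e unfolding uniformly_continuous_on_def by (metis half_gt_zero)
  show "\<exists>d>0. \<forall>v\<in>sphere 0 1. dist v w < d \<longrightarrow> dist (psi K g v) (psi K g w) < e"
  proof (intro exI conjI ballI impI)
    fix v :: 'a assume v: "v \<in> sphere 0 1" "dist v w < d"
    have cont: "continuous_on K1 (\<lambda>y. h (v \<bullet> y) - h (w \<bullet> y))" using v w by (intro continuous_intros cont_K1) auto
    have bd: "\<bar>h (v \<bullet> y) - h (w \<bullet> y)\<bar> \<le> e / 2" if y: "y \<in> K1" for y
    proof -
      have "\<bar>(v - w) \<bullet> y\<bar> \<le> norm (v - w) * norm y" by (rule Cauchy_Schwarz_ineq2)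
      then have "dist (v \<bullet> y) (w \<bullet> y) < d" using v K1_D[OF y] by (simp add: dist_norm inner_diff_left)
      then have "dist (h (v \<bullet> y)) (h (w \<bullet> y)) < e / 2" using inner_K1[of v y] inner_K1[of w y] v w y by (intro d) auto
      then show ?thesis by (simp add: dist_norm)
    qed
    have "psi K g v - psi K g w = (\<integral>y. indicator K1 y *\<^sub>R (h (v \<bullet> y) - h (w \<bullet> y)) \<partial>sphere_measure)"
      unfolding psi_eq using v w
      by (subst set_integral_diff(2)[symmetric]) (auto intro!: K1_integrable cont_K1 simp: set_lebesgue_integral_def)
    also have "\<bar>\<dots>\<bar> \<le> (\<integral>y. \<bar>indicator K1 y *\<^sub>R (h (v \<bullet> y) - h (w \<bullet> y))\<bar> \<partial>sphere_measure)"
      by (rule integral_abs_bound)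
    also have "\<dots> \<le> (\<integral>y. e / 2 \<partial>(sphere_measure :: 'a measure))"
      using K1_integrable[OF cont] bd e
      by (intro integral_mono) (auto simp: set_integrable_def split: split_indicator)
    also have "\<dots> = e / 2" by (simp add: measure_def emeasure_sphere_measure_UNIV)
    finally show "dist (psi K g v) (psi K g w) < e" using e by (simp add: dist_norm)
  qed (rule d)
qed

lemma psi_global_min_exists: "\<exists>w. sphere_global_min (psi K g) w"
proof -
  obtain p where "p \<in> interior K" using interior_K by auto
  from interior_normalize(2)[OF this] have "sphere (0::'a) 1 \<noteq> {}" unfolding K1_def by blast
  then show ?thesis using continuous_attains_inf[OF compact_sphere _ psi_continuous]
    by (auto simp: sphere_global_min_def)
qed

section \<open>Location of the local minimum points\<close>

lemma norm_unit_add_scaleR_sq: "norm w = 1 \<Longrightarrow> (norm (w + t *\<^sub>R a))\<^sup>2 = 1 + 2 * t * (a \<bullet> w) + t\<^sup>2 * (a \<bullet> a)"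
  by (simp add: power2_norm_eq_inner inner_add_left inner_add_right inner_commute)
    (simp add: dot_square_norm power2_eq_square)

text \<open>If \<open>a\<close> separates \<open>w\<close> from \<open>K\<close>, then adding
  \<open>t *\<^sub>R a\<close> does not lower any inner product with \<open>K\<close> and, for small
  \<open>t\<close>, shortens the vector. Normalizing then raises the nonnegative inner products
  further, so the potential drops.\<close>

lemma local_min_dual_imp_in_K:
  assumes w: "sphere_local_min (psi K g) w" and dual: "\<And>y. y \<in> K \<Longrightarrow> 0 \<le> w \<bullet> y"
  shows "w \<in> K"
proof (rule ccontr)
  assume "w \<notin> K"
  then obtain a where a: "\<And>y. y \<in> K \<Longrightarrow> 0 \<le> a \<bullet> y" "a \<bullet> w < 0" using separate_from_K by blast
  have nw: "norm w = 1" using w by (simp add: sphere_local_min_def)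
  have aa: "a \<bullet> a > 0" using a(2) by auto
  \<comment> \<open>For positive \<open>t\<close>, this is exactly the condition that
    \<open>w + t *\<^sub>R a\<close> has norm less than 1.\<close>
  have "eventually (\<lambda>t. t < - 2 * (a \<bullet> w) / (a \<bullet> a)) (at_right 0)"
    using a(2) aa by (intro order_tendstoD(2)[OF tendsto_ident_at]) (simp add: divide_neg_pos)
  with sphere_local_min_perturb[OF w, of a] eventually_at_right_less[of "0::real"]
  have "eventually (\<lambda>t. 0 < t \<and> t < - 2 * (a \<bullet> w) / (a \<bullet> a) \<and> psi K g w \<le> psi K g (sgn (w + t *\<^sub>R a))) (at_right 0)"
    by eventually_elim auto
  then obtain t where t: "0 < t" "t < - 2 * (a \<bullet> w) / (a \<bullet> a)" "psi K g w \<le> psi K g (sgn (w + t *\<^sub>R a))"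
    using eventually_happens'[of "at_right (0::real)"] by auto
  obtain p where p: "p \<in> interior K" using interior_K by auto
  have pos: "0 < w \<bullet> sgn p" using nw by (intro inner_interior_pos dual interior_normalize(1) p) auto
  have inn: "w \<bullet> y \<le> (w + t *\<^sub>R a) \<bullet> y" if "y \<in> K" for y using t(1) a(1)[OF that] by (simp add: inner_add_left)
  have "w + t *\<^sub>R a \<noteq> 0" using inn[of "sgn p"] pos interior_normalize(1)[OF p] K_interior by auto
  then have n0: "norm (w + t *\<^sub>R a) > 0" by simp
  have "t * (a \<bullet> a) < - 2 * (a \<bullet> w)" using t(2) unfolding pos_less_divide_eq[OF aa] .
  then have "t * (2 * (a \<bullet> w) + t * (a \<bullet> a)) < 0" using t(1) by (simp add: mult_pos_neg)
  then have "(norm (w + t *\<^sub>R a))\<^sup>2 < 1\<^sup>2"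
    unfolding norm_unit_add_scaleR_sq[OF nw] by (simp add: algebra_simps power2_eq_square)
  then have n1: "norm (w + t *\<^sub>R a) < 1" by (rule power2_less_imp_less) simp
  have "psi K g (sgn (w + t *\<^sub>R a)) < psi K g w"
  proof (rule psi_less[OF _ nw])
    show "norm (sgn (w + t *\<^sub>R a)) = 1" using n0 by (simp add: norm_sgn)
    show "w \<bullet> y \<le> sgn (w + t *\<^sub>R a) \<bullet> y" if "y \<in> K1" for y
    proof -
      have "(w \<bullet> y) * norm (w + t *\<^sub>R a) \<le> (w \<bullet> y) * 1"
        using n1 dual[OF K1_D(1)[OF that]] by (intro mult_left_mono) auto
      also have "\<dots> \<le> (w + t *\<^sub>R a) \<bullet> y" using inn[OF K1_D(1)[OF that]] by simp
      finally show ?thesis using n0 by (simp add: inner_sgn_left pos_le_divide_eq)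
    qed
    show "sgn p \<in> K1" by (rule interior_normalize(2)[OF p])
    have "(w \<bullet> sgn p) * norm (w + t *\<^sub>R a) < (w \<bullet> sgn p) * 1"
      using n1 pos by (intro mult_strict_left_mono) auto
    also have "\<dots> \<le> (w + t *\<^sub>R a) \<bullet> sgn p" using inn interior_normalize(1)[OF p] K_interior by simp
    finally show "w \<bullet> sgn p < sgn (w + t *\<^sub>R a) \<bullet> sgn p" using n0 
      by (simp add: inner_sgn_left[of "w + t *\<^sub>R a"] pos_less_divide_eq)
  qed
  with t(3) show False by simp
qed

lemma local_min_imp_dual:
  assumes dim: "DIM('a) \<ge> 2" and w: "sphere_local_min (psi K g) w" and y: "y \<in> K"
  shows "0 \<le> w \<bullet> y"
proof (rule ccontr)
  assume "\<not> 0 \<le> w \<bullet> y"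
  then have neg: "w \<bullet> y < 0" by simp
  have nw: "norm w = 1" using w by (simp add: sphere_local_min_def)
  have ww: "w \<bullet> w = 1" using nw by (simp add: dot_square_norm)
  obtain p where p: "p \<in> interior K" using interior_K by auto
  have "((\<lambda>t. w \<bullet> (y + t *\<^sub>R p)) \<longlongrightarrow> w \<bullet> (y + 0 *\<^sub>R p)) (at_right 0)" by (intro tendsto_intros)
  then have "eventually (\<lambda>t. w \<bullet> (y + t *\<^sub>R p) < 0) (at_right 0)" by (rule order_tendstoD) (simp add: neg)
  with eventually_at_right_less[of "0::real"] have "eventually (\<lambda>t. 0 < t \<and> w \<bullet> (y + t *\<^sub>R p) < 0) (at_right 0)"
    by eventually_elim auto
  then obtain t where t: "0 < t" "w \<bullet> (y + t *\<^sub>R p) < 0"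
    using eventually_happens'[of "at_right (0::real)"] by auto
  \<comment> \<open>The point \<open>y\<close> is pushed into the interior with
    \<open>w \<bullet> x\<close> still negative, so that \<open>x\<close> can serve in
    reflections.\<close>
  define x where "x = t *\<^sub>R p + y"
  have x: "x \<in> interior K" "w \<bullet> x < 0"
    using interior_add[OF interior_scale[OF p t(1)] y] t(2) by (auto simp: x_def add.commute)
  have no_orth: "w \<bullet> z \<noteq> 0" if z: "z \<in> K" "z \<noteq> 0" for z
  proof
    assume wz: "w \<bullet> z = 0"
    \<comment> \<open>For positive \<open>t\<close> the reflection in the hyperplane orthogonal to
      \<open>?q t\<close> lowers the potential. As \<open>t\<close> tends to 0, the reflected points
      tend to the mirror image of \<open>w\<close> in the hyperplane orthogonal to \<open>z\<close>,
      which is \<open>w\<close> itself.\<close>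
    let ?q = "\<lambda>t. t *\<^sub>R x + z"
    let ?c = "\<lambda>t. w - (2 * (w \<bullet> ?q t) / (?q t \<bullet> ?q t)) *\<^sub>R ?q t"
    have less: "psi K g (?c t) < psi K g w" if "t > 0" for t
      using that x wz by (intro psi_reflect_less interior_add interior_scale z nw)
        (auto simp: inner_add_right mult_pos_neg)
    have norm: "norm (?c t) = 1" if "t > 0" for t
    proof -
      have "?q t \<in> interior K" using that by (intro interior_add interior_scale x z)
      then have "?q t \<noteq> 0" using zero_notin_interior by metis
      then have "?q t \<bullet> ?q t \<noteq> 0" unfolding inner_eq_zero_iff .
      then have "?c t \<bullet> ?c t = w \<bullet> w"
        by (simp only: inner_diff_left inner_diff_right inner_scaleR_left inner_scaleR_right inner_commute[of "?q t" w])
          (simp add: field_simps)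
      then show ?thesis by (simp add: norm_eq_sqrt_inner ww)
    qed
    have "(?c \<longlongrightarrow> w - (2 * (w \<bullet> ?q 0) / (?q 0 \<bullet> ?q 0)) *\<^sub>R ?q 0) (at_right 0)"
      using z by (intro tendsto_intros) auto
    then have "(?c \<longlongrightarrow> w) (at_right 0)" by (simp add: wz)
    then have "eventually (\<lambda>t. psi K g w \<le> psi K g (?c t)) (at_right 0)"
      by (rule sphere_local_min_eventually[OF w])
        (use norm eventually_at_right_less[of "0::real"] in \<open>auto elim!: eventually_mono\<close>)
    with eventually_at_right_less[of "0::real"] have "eventually (\<lambda>t. 0 < t \<and> psi K g w \<le> psi K g (?c t)) (at_right 0)"
      by eventually_elim auto
    then obtain t where "0 < t" "psi K g w \<le> psi K g (?c t)"
      using eventually_happens'[of "at_right (0::real)"] by auto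
    with less show False by fastforce
  qed
  have all_neg: "w \<bullet> z < 0" if z: "z \<in> K" "z \<noteq> 0" for z
  proof (rule ccontr)
    assume "\<not> w \<bullet> z < 0"
    with no_orth[OF z] have pos: "w \<bullet> z > 0" by simp
    \<comment> \<open>If \<open>w\<close> changed sign on \<open>K\<close>, this positive
      combination of \<open>x\<close> and \<open>z\<close> would be an interior point orthogonal to
      \<open>w\<close>.\<close>
    let ?v = "(w \<bullet> z) *\<^sub>R x + (- (w \<bullet> x)) *\<^sub>R z"
    have "?v \<in> interior K" using x z pos by (intro interior_add interior_scale K_scale) auto
    moreover from this have "?v \<noteq> 0" using zero_notin_interior by metis
    moreover have "w \<bullet> ?v = 0" by (simp add: inner_add_right inner_diff_right)
    ultimately show False using no_orth K_interior by blast
  qed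
  show False
  proof (cases "- w \<in> K")
    case False
    \<comment> \<open>Now \<open>a \<bullet> w\<close> is positive, so
      \<open>w + t *\<^sub>R a\<close> has norm above 1. Its normalization shrinks negative inner
      products towards 0, and the potential drops.\<close>
    then obtain a where a: "\<And>y. y \<in> K \<Longrightarrow> 0 \<le> a \<bullet> y" "a \<bullet> (- w) < 0" using separate_from_K by blast
    from sphere_local_min_perturb[OF w, of a] eventually_at_right_less[of "0::real"]
    have "eventually (\<lambda>t. 0 < t \<and> psi K g w \<le> psi K g (sgn (w + t *\<^sub>R a))) (at_right 0)"
      by eventually_elim auto
    then obtain t where t: "0 < t" "psi K g w \<le> psi K g (sgn (w + t *\<^sub>R a))"
      using eventually_happens'[of "at_right (0::real)"] by auto
    have "(norm (w + t *\<^sub>R a))\<^sup>2 > 1\<^sup>2"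
      unfolding norm_unit_add_scaleR_sq[OF nw] using t(1) a(2) by (simp add: add_pos_nonneg)
    then have n1: "norm (w + t *\<^sub>R a) > 1" by (rule power2_less_imp_less) simp
    have lt: "w \<bullet> y < sgn (w + t *\<^sub>R a) \<bullet> y" if "y \<in> K1" for y
    proof -
      have "w \<bullet> y < 0" using K1_D[OF that] by (intro all_neg) auto
      then have "(w \<bullet> y) * norm (w + t *\<^sub>R a) < (w \<bullet> y) * 1"
        using n1 by (intro mult_strict_left_mono_neg) auto
      also have "\<dots> \<le> (w + t *\<^sub>R a) \<bullet> y" using t(1) a(1)[OF K1_D(1)[OF that]] by (simp add: inner_add_left)
      finally show ?thesis
        using n1 unfolding inner_sgn_left by (subst pos_less_divide_eq) auto
    qed
    have "psi K g (sgn (w + t *\<^sub>R a)) < psi K g w"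
      using n1 by (intro psi_less[OF _ nw _ interior_normalize(2)[OF p]] lt interior_normalize(2)[OF p] less_imp_le)
        (auto simp: norm_sgn)
    with t(2) show False by simp
  next
    case True
    \<comment> \<open>The dimension assumption supplies a direction tangent to the sphere at
      \<open>w\<close>.\<close>
    obtain v0 where v0: "v0 \<noteq> 0" "orthogonal w v0" using orthogonal_to_vector_exists[of w] dim by auto
    define v where "v = sgn v0"
    have v: "norm v = 1" "w \<bullet> v = 0" "v \<bullet> w = 0"
      using v0 by (auto simp: v_def norm_sgn orthogonal_def sgn_div_norm inner_commute)
    have "K1 \<noteq> {}" using interior_normalize(2)[OF p] by auto
    \<comment> \<open>By compactness \<open>w \<bullet> y\<close> stays below 0 on \<open>K1\<close>
      by the gap \<open>- (w \<bullet> z)\<close>. For \<open>t\<close> smaller than this gap, both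
      neighbours of \<open>w\<close> along \<open>v\<close> and \<open>- v\<close> still have
      nonpositive inner products with \<open>K\<close>.\<close>
    then obtain z where z: "z \<in> K1" "\<And>y. y \<in> K1 \<Longrightarrow> w \<bullet> y \<le> w \<bullet> z"
      using continuous_attains_sup[OF compact_K1, of "\<lambda>y. w \<bullet> y"] continuous_on_inner[OF continuous_on_const continuous_on_id]
      by blast
    have wz: "w \<bullet> z < 0" using K1_D[OF z(1)] by (intro all_neg) auto
    then have "eventually (\<lambda>t. t < - (w \<bullet> z)) (at_right 0)"
      by (intro order_tendstoD(2)[OF tendsto_ident_at]) simp
    with sphere_local_min_perturb[OF w, of v] sphere_local_min_perturb[OF w, of "- v"] eventually_at_right_less[of "0::real"]
    have "eventually (\<lambda>t. 0 < t \<and> t < - (w \<bullet> z) \<and> psi K g w \<le> psi K g (sgn (w + t *\<^sub>R v)) \<and>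
       psi K g w \<le> psi K g (sgn (w + t *\<^sub>R - v))) (at_right 0)"
      by eventually_elim auto
    then obtain t where t: "0 < t" "t < - (w \<bullet> z)" "psi K g w \<le> psi K g (sgn (w + t *\<^sub>R v))"
        "psi K g w \<le> psi K g (sgn (w + t *\<^sub>R - v))"
      using eventually_happens'[of "at_right (0::real)"] by auto
    define r where "r = sqrt (1 + t\<^sup>2)"
    have r: "r > 0" by (auto simp: r_def add_pos_nonneg)
    have vv: "v \<bullet> v = 1" using v by (simp add: dot_square_norm)
    have n: "norm (w + t *\<^sub>R v) = r" "norm (w + t *\<^sub>R - v) = r"
      unfolding r_def norm_eq_sqrt_inner
      by (simp_all add: inner_add_left inner_add_right inner_diff_left inner_diff_right v vv ww power2_eq_square)
    have nonpos: "sgn (w + t *\<^sub>R s) \<bullet> y \<le> 0" if s: "s = v \<or> s = - v" and y: "y \<in> K" for s y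
    proof (cases "y = 0")
      case False
      have "sgn y \<in> K1" using False K_scale[OF y, of "inverse (norm y)"] by (simp add: K1_def sgn_div_norm)
      then have "w \<bullet> sgn y \<le> w \<bullet> z" by (rule z)
      moreover have "\<bar>s \<bullet> sgn y\<bar> \<le> 1" using s v False by (intro abs_inner_unit) (auto simp: norm_sgn)
      then have "t * (s \<bullet> sgn y) \<le> t * 1" using t(1) by (intro mult_left_mono) auto
      ultimately have "(w + t *\<^sub>R s) \<bullet> sgn y \<le> 0" using t(2) by (simp add: inner_add_left)
      then have "(w + t *\<^sub>R s) \<bullet> y \<le> 0"
        using False by (simp add: sgn_div_norm mult_le_0_iff)
      then show ?thesis by (simp add: inner_sgn_left divide_nonpos_nonneg)
    qed simp
    \<comment> \<open>The point \<open>w\<close> is the midpoint of the arc between the two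
      neighbours, so by strict concavity they cannot both have values at least
      \<open>psi K g w\<close>.\<close>
    have "psi K g (sgn (w + t *\<^sub>R v)) + psi K g (sgn (w + t *\<^sub>R - v)) < 2 * psi K g w"
    proof (rule psi_midpoint_less(2))
      show "norm (sgn (w + t *\<^sub>R v)) = 1" "norm (sgn (w + t *\<^sub>R - v)) = 1"
        using n r by (auto simp: norm_sgn)
      show "norm w = 1" "- w \<in> K" by fact+
      show "2 / r > 0" using r by simp
      show "sgn (w + t *\<^sub>R v) + sgn (w + t *\<^sub>R - v) = (2 / r) *\<^sub>R w"
        unfolding sgn_div_norm n by (simp add: algebra_simps divide_inverse flip: scaleR_2)
      have "sgn (w + t *\<^sub>R v) \<bullet> v \<noteq> sgn (w + t *\<^sub>R - v) \<bullet> v"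
        unfolding inner_sgn_left n using r t(1) by (simp add: inner_add_left inner_diff_left v vv)
      then show "sgn (w + t *\<^sub>R v) \<noteq> sgn (w + t *\<^sub>R - v)" by metis
    qed (auto intro!: nonpos[of v, simplified] nonpos[of "- v", simplified])
    with t show False by simp
  qed
qed

section \<open>Comparison on the dual cone and uniqueness\<close>

lemma dual_add_ne_zero:
  assumes "norm u = 1" "norm v = 1" "\<And>y. y \<in> K \<Longrightarrow> 0 \<le> u \<bullet> y" "\<And>y. y \<in> K \<Longrightarrow> 0 \<le> v \<bullet> y"
  shows "u + v \<noteq> 0"
proof
  assume 0: "u + v = 0"
  obtain p where p: "p \<in> interior K" using interior_K by auto
  have "0 < u \<bullet> p" "0 < v \<bullet> p" using assms p by (auto intro!: inner_interior_pos)
  then have "0 < (u + v) \<bullet> p" by (simp add: inner_add_left)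
  with 0 show False by simp
qed

text \<open>Midpoint convexity on the dual cone: repeatedly halving the arc towards a local minimum
  point produces ever closer points that would have smaller values.\<close>
lemma local_min_le_dual:
  assumes w: "sphere_local_min (psi K g) w" and wK: "\<And>y. y \<in> K \<Longrightarrow> 0 \<le> w \<bullet> y"
    and v: "norm v = 1" and vK: "\<And>y. y \<in> K \<Longrightarrow> 0 \<le> v \<bullet> y"
  shows "psi K g w \<le> psi K g v"
proof (rule ccontr)
  assume "\<not> psi K g w \<le> psi K g v"
  then have less: "psi K g v < psi K g w" by simp
  have nw: "norm w = 1" using w by (simp add: sphere_local_min_def)
  define u where "u k = ((\<lambda>x. sgn (x + w)) ^^ k) v" for k
  have u0: "u 0 = v" and uS: "u (Suc k) = sgn (u k + w)" for k by (simp_all add: u_def)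
  \<comment> \<open>The last conjunct measures closeness to \<open>w\<close>: it starts from the
    trivial bound 2 and is halved at each step.\<close>
  have inv: "norm (u k) = 1 \<and> (\<forall>y\<in>K. 0 \<le> u k \<bullet> y) \<and> psi K g (u k) < psi K g w \<and>
      1 - u k \<bullet> w \<le> 2 * (1/2) ^ k" for k
  proof (induction k)
    case 0
    then show ?case using v vK less abs_inner_unit[OF v nw] by (auto simp: u0)
  next
    case (Suc k)
    then have uk: "norm (u k) = 1" "\<And>y. y \<in> K \<Longrightarrow> 0 \<le> u k \<bullet> y" "psi K g (u k) < psi K g w"
      "1 - u k \<bullet> w \<le> 2 * (1/2) ^ k" by auto
    let ?N = "norm (u k + w)"
    have ne: "u k + w \<noteq> 0" by (rule dual_add_ne_zero[OF uk(1) nw uk(2) wK])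
    have eq: "u k + w = ?N *\<^sub>R u (Suc k)" using ne by (simp add: uS sgn_div_norm)
    have n1: "norm (u (Suc k)) = 1" using ne by (simp add: uS norm_sgn)
    have "2 * psi K g (u (Suc k)) \<le> psi K g (u k) + psi K g w"
      by (rule psi_midpoint_le[OF uk(1) nw n1 _ eq]) (use ne uk(2) wK in auto)
    then have psi_less: "psi K g (u (Suc k)) < psi K g w" using uk(3) by simp
    have dual: "0 \<le> u (Suc k) \<bullet> y" if "y \<in> K" for y
      using uk(2)[OF that] wK[OF that] by (simp add: uS inner_sgn_left inner_add_left)
    \<comment> \<open>The inner product of the normalized midpoint with \<open>w\<close> is
      \<open>(1 + u k \<bullet> w) / ?N\<close> with \<open>?N \<le> 2\<close>, which yields the
      halving.\<close>
    have "(1 + u k \<bullet> w) / 2 \<le> u (Suc k) \<bullet> w"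
    proof -
      have "?N \<le> 2" using norm_triangle_ineq[of "u k" w] uk(1) nw by simp
      moreover have "0 \<le> 1 + u k \<bullet> w" using abs_inner_unit[OF uk(1) nw] by simp
      ultimately have "(1 + u k \<bullet> w) / 2 \<le> (1 + u k \<bullet> w) / ?N" using ne by (intro divide_left_mono) auto
      then show ?thesis
        using nw by (simp add: uS inner_sgn_left inner_add_left dot_square_norm add.commute)
    qed
    moreover have "1 - s' \<le> 2 * (1/2 * p)" if "(1 + s) / 2 \<le> s'" "1 - s \<le> 2 * p" for s s' p :: real
      using that by simp
    ultimately have "1 - u (Suc k) \<bullet> w \<le> 2 * (1/2) ^ Suc k" using uk(4) unfolding power_Suc by blast
    then show ?case using n1 psi_less dual by blast
  qed
  have "(\<lambda>k. (dist (u k) w)\<^sup>2) \<longlonglongrightarrow> 0"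
  proof (rule tendsto_sandwich)
    show "\<forall>\<^sub>F k in sequentially. 0 \<le> (dist (u k) w)\<^sup>2" by simp
    have "(dist (u k) w)\<^sup>2 \<le> 4 * (1/2) ^ k" for k
    proof -
      have "(dist (u k) w)\<^sup>2 = 2 * (1 - u k \<bullet> w)"
        using inv[of k] nw by (simp add: dist_norm power2_norm_eq_inner inner_diff_left inner_diff_right inner_commute)
          (simp add: dot_square_norm)
      also have "\<dots> \<le> 4 * (1/2) ^ k" using inv[of k] by simp
      finally show ?thesis .
    qed
    then show "\<forall>\<^sub>F k in sequentially. (dist (u k) w)\<^sup>2 \<le> 4 * (1/2) ^ k" by simp
    show "(\<lambda>k. 4 * (1/2) ^ k) \<longlonglongrightarrow> (0::real)" by (intro tendsto_mult_right_zero LIMSEQ_power_zero) simp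
  qed simp
  then have "u \<longlonglongrightarrow> w" using tendsto_dist_iff[of u w] tendsto_real_sqrt[of "\<lambda>k. (dist (u k) w)\<^sup>2" 0] by simp
  then have "eventually (\<lambda>k. psi K g w \<le> psi K g (u k)) sequentially"
    by (rule sphere_local_min_eventually[OF w]) (use inv in auto)
  then obtain k where "psi K g w \<le> psi K g (u k)" by (auto simp: eventually_sequentially)
  with inv[of k] show False by simp
qed

text \<open>Both points lie in the dual cone, so \<open>local_min_le_dual\<close> gives them equal
  values. Their midpoint \<open>m\<close> is then a global minimum point and therefore lies in
  \<open>K\<close>, where midpoint convexity is strict.\<close>

lemma local_min_eq_global_min:
  assumes dim: "DIM('a) \<ge> 2" and u: "sphere_local_min (psi K g) u" and w: "sphere_global_min (psi K g) w"
  shows "u = w"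
proof (rule ccontr)
  assume uw: "u \<noteq> w"
  have lw: "sphere_local_min (psi K g) w" using w by (rule sphere_global_min_imp_local_min)
  have n: "norm u = 1" "norm w = 1" using u lw by (auto simp: sphere_local_min_def)
  note uK = local_min_imp_dual[OF dim u] and wK = local_min_imp_dual[OF dim lw]
  have eq: "psi K g u \<le> psi K g w" by (rule local_min_le_dual[OF u uK n(2) wK])
  define m where "m = sgn (u + w)"
  have ne: "u + w \<noteq> 0" by (rule dual_add_ne_zero[OF n uK wK])
  then have m: "norm m = 1" "norm (u + w) > 0" "u + w = norm (u + w) *\<^sub>R m"
    by (auto simp: m_def norm_sgn sgn_div_norm)
  have mK: "0 \<le> m \<bullet> y" if "y \<in> K" for y
    using uK[OF that] wK[OF that] by (simp add: m_def inner_sgn_left inner_add_left)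
  have "2 * psi K g m \<le> psi K g u + psi K g w" by (rule psi_midpoint_le[OF n m uK wK])
  then have "sphere_global_min (psi K g) m" using eq w m(1) unfolding sphere_global_min_def by fastforce
  then have mloc: "sphere_local_min (psi K g) m" by (rule sphere_global_min_imp_local_min)
  have "m \<in> K" by (rule local_min_dual_imp_in_K[OF mloc mK])
  then have "2 * psi K g m < psi K g u + psi K g w" by (intro psi_midpoint_less(1)[OF n m(1) uw m(2,3)] uK wK)
  moreover have "psi K g w \<le> psi K g m" using w m(1) by (simp add: sphere_global_min_def)
  ultimately show False using eq by simp
qed

end

theorem mainTheorem7:
  fixes K :: "'a::euclidean_space set" and g :: "real \<Rightarrow> real"
  assumes "DIM('a) \<ge> 2"
    and "closed K" and "convex_cone K" and "proper_cone K" and "interior K \<noteq> {}"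
    and "continuous_on {0..pi} g" and "strict_mono_on {0..pi} g"
    and "convex_on {0..pi/2} g" and "concave_on {pi/2..pi} g"
  shows "(\<exists>!w. sphere_global_min (psi K g) w) \<and>
    (\<forall>u w. sphere_local_min (psi K g) u \<and> sphere_global_min (psi K g) w \<longrightarrow> u = w)"
proof -
  interpret cone_potential K g by unfold_locales fact+
  show ?thesis
    using psi_global_min_exists local_min_eq_global_min[OF assms(1)] sphere_global_min_imp_local_min by blast
qed

end
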